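(* Let $\mu>0$ and assume that $A_\xi:\mathcal{X}\to 2^{\mathcal{X}}$ is $\mu$-strongly maximally monotone for every $\xi\sim\mathcal{D}$, so that $A:=\mathrm{E}_{\xi\sim\mathcal{D}}[A_\xi]$ is $\mu$-strongly maximally monotone as well and the solution $x^\star$ of $0\in A(x^\star)$ exists and is unique (these consequences are part of the assumption). Assume moreover that expected similarity holds with constant $\delta>0$: for every $x\in\mathcal{X}$ and every family $a_\xi\in A_\xi(x)$, $\xi\sim\mathcal{D}$, there exists a family $a_\xi^\star\in A_\xi(x^\star)$, $\xi\sim\mathcal{D}$, such that $\mathrm{E}_{\xi\sim\mathcal{D}}[a_\xi^\star]=0$ and $$\mathrm{E}_{\xi\sim\mathcal{D}}\left[\left\|a_\xi-\mathrm{E}_{\xi'\sim\mathcal{D}}[a_{\xi'}]-a_\xi^\star\right\|^2\right]\le\delta^2\|x-x^\star\|^2.$$ Let $(x^k,w^k)_{k\ge0}$ be generated by the algorithm L-SVRP described in the context, with any stepsize $\gamma>0$, any probability $p\in(0,1]$ and any initial estimates $x^0,w^0\in\mathcal{X}$. Define the Lyapunov function $$V^k:=\|x^k-x^\star\|^2+\frac{\gamma\mu}{p}\|w^k-x^\star\|^2.$$ Then, for every $k\ge0$, $$\mathrm{E}\left[V^k\right]\le\max\left\{\frac{1}{1+\gamma\mu},\;1-p+\frac{\gamma\delta^2p}{\mu(1+\gamma\mu)}\right\}^kV^0.$$ Moreover, $x^k$ and $w^k$ converge to $x^\star$ almost surely.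
   Context: $\mathcal{X}$ is a finite-dimensional real Hilbert space with inner product $\langle\cdot,\cdot\rangle$ and norm $\|\cdot\|$; $I$ is the identity; $\mathcal{D}$ is a probability distribution. A set-valued operator $B:\mathcal{X}\to 2^{\mathcal{X}}$ has graph $\mathrm{gra}(B)=\{(x,u):u\in B(x)\}$. $B$ is monotone if $\langle u-v,x-y\rangle\ge 0$ for all $(x,u),(y,v)\in\mathrm{gra}(B)$; maximally monotone if moreover no monotone operator has a graph strictly containing $\mathrm{gra}(B)$; $\mu$-strongly maximally monotone if it is maximally monotone and $\langle u-v,x-y\rangle\ge\mu\|x-y\|^2$ for all $(x,u),(y,v)\in\mathrm{gra}(B)$. If $B$ is maximally monotone, the resolvent $(I+B)^{-1}$ is defined everywhere and single-valued. The operator $A=\mathrm{E}_{\xi\sim\mathcal{D}}[A_\xi]$ is understood through selections: $u\in A(x)$ if and only if there is a family $a_\xi\in A_\xi(x)$ with $\mathrm{E}_{\xi\sim\mathcal{D}}[a_\xi]=u$. All families (selections) are implicitly measurable and integrable in $\xi$. Algorithm L-SVRP (Loopless Stochastic Variance-Reduced Proximal Point Method), with stepsize $\gamma>0$, initial estimates $x^0,w^0\in\mathcal{X}$, probability $p\in(0,1]$, and $a^0\in A(w^0)$: for $k=0,1,\ldots$ 1. sample $\xi^k\sim\mathcal{D}$ (independently of the past); 2. choose $a_{\xi^k}^k\in A_{\xi^k}(w^k)$ so that $\mathrm{E}_{\xi\sim\mathcal{D}}[a_\xi^k]=a^k$, where $a_\xi^k\in A_\xi(w^k)$ (the family $(a_\xi^k)_\xi$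 depends only on the past, not on $\xi^k$); 3. set $h^k:=a_{\xi^k}^k-a^k$; 4. set $x^{k+1}:=(I+\gamma A_{\xi^k})^{-1}(x^k+\gamma h^k)$; 5. flip a coin $\theta^k\in\{0,1\}$ with $\mathrm{Prob}(\theta^k=1)=p$ (independently of everything else); 6. if $\theta^k=1$, set $w^{k+1}:=x^{k+1}$ and let $a^{k+1}$ be any element of $A(x^{k+1})$; if $\theta^k=0$, set $w^{k+1}:=w^k$ and $a^{k+1}:=a^k$. It is implicit that the required elements exist and that the choices are measurable.
   Formalization: Almost sure convergence of x^k and w^k is claimed only when the maximum in the bound is less than 1; for large stepsizes the iterates can diverge almost surely (e.g. A_ξ(x)=c_ξ x, c_ξ∈{1,100} equally likely, γ=100, p=1, x^0=w^0≠0). *)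

theory Defs
  imports "HOL-Probability.Probability" "HOL-Probability.Stopping_Time"
begin

section \<open>Set-valued operators\<close>

definition gra :: "('a \<Rightarrow> 'a set) \<Rightarrow> ('a \<times> 'a) set" where
  "gra B = {(x, u). u \<in> B x}"

definition monotone_op :: "('a::real_inner \<Rightarrow> 'a set) \<Rightarrow> bool" where
  "monotone_op B \<longleftrightarrow>
     (\<forall>(x, u)\<in>gra B. \<forall>(y, v)\<in>gra B. 0 \<le> (u - v) \<bullet> (x - y))"

definition maximally_monotone :: "('a::real_inner \<Rightarrow> 'a set) \<Rightarrow> bool" where
  "maximally_monotone B \<longleftrightarrow>
     monotone_op B \<and> \<not> (\<exists>C. monotone_op C \<and> gra B \<subset> gra C)"

definition strongly_maximally_monotone :: "real \<Rightarrow> ('a::real_inner \<Rightarrow> 'a set) \<Rightarrow> bool" where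
  "strongly_maximally_monotone \<mu> B \<longleftrightarrow>
     maximally_monotone B \<and>
     (\<forall>(x, u)\<in>gra B. \<forall>(y, v)\<in>gra B. \<mu> * (norm (x - y))\<^sup>2 \<le> (u - v) \<bullet> (x - y))"

text \<open>
  The resolvent \<open>(I + \<gamma> B)\<^sup>-\<^sup>1\<close> as a set-valued operator: the set of all \<open>y\<close> with
  \<open>z \<in> y + \<gamma> B y\<close>. It has at most one element when \<open>B\<close> is monotone (lemma below), and exactly
  one when \<open>B\<close> is maximally monotone, so for such \<open>B\<close> membership in it is equality with the
  value of the usual single-valued resolvent.
\<close>

definition resolvent :: "real \<Rightarrow> ('a::real_vector \<Rightarrow> 'a set) \<Rightarrow> 'a \<Rightarrow> 'a set" where
  "resolvent \<gamma> B z = {y. \<exists>u\<in>B y. z = y + \<gamma> *\<^sub>R u}"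

lemma resolvent_unique:
  assumes "monotone_op B" "0 \<le> \<gamma>" "y \<in> resolvent \<gamma> B z" "y' \<in> resolvent \<gamma> B z"
  shows "y = y'"
proof -
  obtain u where u: "u \<in> B y" "z = y + \<gamma> *\<^sub>R u"
    using assms(3) by (auto simp: resolvent_def)
  obtain v where v: "v \<in> B y'" "z = y' + \<gamma> *\<^sub>R v"
    using assms(4) by (auto simp: resolvent_def)
  have "0 \<le> \<gamma> * ((u - v) \<bullet> (y - y'))"
    using assms(1,2) u(1) v(1) by (auto simp: monotone_op_def gra_def)
  also have "\<dots> = (\<gamma> *\<^sub>R u - \<gamma> *\<^sub>R v) \<bullet> (y - y')"
    by (simp flip: scaleR_diff_right)
  also have "\<gamma> *\<^sub>R u - \<gamma> *\<^sub>R v = - (y - y')"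
    using u(2) v(2) by (simp add: algebra_simps)
  finally have "(y - y') \<bullet> (y - y') \<le> 0"
    unfolding inner_minus_left by linarith
  then show ?thesis
    using inner_ge_zero[of "y - y'"] inner_eq_zero_iff[of "y - y'"] by auto
qed


section \<open>Random operators and their expectation\<close>

definition selection ::
  "'s measure \<Rightarrow> ('s \<Rightarrow> 'a::euclidean_space \<Rightarrow> 'a set) \<Rightarrow> 'a \<Rightarrow> ('s \<Rightarrow> 'a) \<Rightarrow> bool" where
  "selection D A x a \<longleftrightarrow> integrable D a \<and> (\<forall>\<xi>\<in>space D. a \<xi> \<in> A \<xi> x)"

definition expected_op ::
  "'s measure \<Rightarrow> ('s \<Rightarrow> 'a::euclidean_space \<Rightarrow> 'a set) \<Rightarrow> 'a \<Rightarrow> 'a set" where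
  "expected_op D A x = {u. \<exists>a. selection D A x a \<and> (\<integral>\<xi>. a \<xi> \<partial>D) = u}"

definition expected_similarity ::
  "'s measure \<Rightarrow> ('s \<Rightarrow> 'a::euclidean_space \<Rightarrow> 'a set) \<Rightarrow> 'a \<Rightarrow> real \<Rightarrow> bool" where
  "expected_similarity D A xs \<delta> \<longleftrightarrow>
     (\<forall>x a. selection D A x a \<longrightarrow>
        (\<exists>as. selection D A xs as \<and> (\<integral>\<xi>. as \<xi> \<partial>D) = 0 \<and>
              integrable D (\<lambda>\<xi>. (norm (a \<xi> - (\<integral>\<xi>'. a \<xi>' \<partial>D) - as \<xi>))\<^sup>2) \<and>
              (\<integral>\<xi>. (norm (a \<xi> - (\<integral>\<xi>'. a \<xi>' \<partial>D) - as \<xi>))\<^sup>2 \<partial>D) \<le> \<delta>\<^sup>2 * (norm (x - xs))\<^sup>2))"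


section \<open>The algorithm\<close>

text \<open>The \<open>\<sigma>\<close>-algebra on \<open>\<Omega>\<close> generated by the random element \<open>X\<close> of \<open>N\<close>.\<close>

abbreviation events_of :: "'w set \<Rightarrow> ('w \<Rightarrow> 'b) \<Rightarrow> 'b measure \<Rightarrow> 'w set set" where
  "events_of \<Omega> X N \<equiv> sets (vimage_algebra \<Omega> X N)"

text \<open>
  A run of the method on a probability space \<open>M\<close>. The filtration \<open>F\<close> is the information flow:
  \<open>F k\<close> is the past of iteration \<open>k\<close>, i.e. what is known just before \<open>\<xi>\<^sup>k\<close> is sampled. It may be
  larger than the \<open>\<sigma>\<close>-algebra generated by the earlier samples and coins, so the choices
  left open by the method may themselves be randomized.

  \<open>fam k \<omega> :: 's \<Rightarrow> 'a\<close> is the family \<open>(a\<^sub>\<xi>\<^sup>k)\<^sub>\<xi>\<close> chosen in iteration \<open>k\<close>. It may depend on the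
  past but not on \<open>\<xi>\<^sup>k\<close>; hence measurability is required on \<open>F k \<Otimes>\<^sub>M D\<close>.
  The method uses only its member with index \<open>\<xi> k \<omega>\<close>.

  The map \<open>T\<close> in \<open>prox_step\<close> sends a past and a sample to the resulting iterate \<open>x\<^bsup>k+1\<^esup>\<close>. By
  uniqueness of the resolvent the membership condition determines \<open>T\<close>, so the
  content of this assumption is that \<open>x\<^bsup>k+1\<^esup>\<close> is the resolvent and that it is a measurable
  function of the past and of \<open>\<xi>\<^sup>k\<close>.

  The pair \<open>(\<omega>, \<xi> k \<omega>)\<close> in \<open>coin_indep\<close> generates the \<open>\<sigma>\<close>-algebra of the past together with \<open>\<xi>\<^sup>k\<close>.
\<close>

locale lsvrp = prob_space M + D: prob_space D + filtration "space M" F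
  for M :: "'w measure" and D :: "'s measure" and F :: "nat \<Rightarrow> 'w measure" +
  fixes A :: "'s \<Rightarrow> 'a::euclidean_space \<Rightarrow> 'a set"
    and \<gamma> p :: real
    and x0 w0 a0 :: 'a
    and \<xi> :: "nat \<Rightarrow> 'w \<Rightarrow> 's"
    and \<theta> :: "nat \<Rightarrow> 'w \<Rightarrow> bool"
    and fam :: "nat \<Rightarrow> 'w \<Rightarrow> 's \<Rightarrow> 'a"
    and a x w :: "nat \<Rightarrow> 'w \<Rightarrow> 'a"
  assumes past: "subalgebra M (F k)"
    and sample_measurable: "\<xi> k \<in> F (Suc k) \<rightarrow>\<^sub>M D"
    and sample_distr: "distr M D (\<xi> k) = D"
    and sample_indep: "indep_set (sets (F k)) (events_of (space M) (\<xi> k) D)"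
    and coin_measurable: "\<theta> k \<in> F (Suc k) \<rightarrow>\<^sub>M count_space UNIV"
    and coin_prob: "prob {\<omega>\<in>space M. \<theta> k \<omega>} = p"
    and coin_indep:
      "indep_set (events_of (space M) (\<lambda>\<omega>. (\<omega>, \<xi> k \<omega>)) (F k \<Otimes>\<^sub>M D))
                 (events_of (space M) (\<theta> k) (count_space UNIV))"
    and a0_in: "a0 \<in> expected_op D A w0"
    and init: "\<omega> \<in> space M \<Longrightarrow> x 0 \<omega> = x0 \<and> w 0 \<omega> = w0 \<and> a 0 \<omega> = a0"
    and a_measurable: "a k \<in> F k \<rightarrow>\<^sub>M borel"
    and fam_measurable: "(\<lambda>(\<omega>, s). fam k \<omega> s) \<in> F k \<Otimes>\<^sub>M D \<rightarrow>\<^sub>M borel"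
    and fam_selection:
      "\<omega> \<in> space M \<Longrightarrow> selection D A (w k \<omega>) (fam k \<omega>) \<and> (\<integral>s. fam k \<omega> s \<partial>D) = a k \<omega>"
    and prox_step:
      "\<exists>T. (\<lambda>(\<omega>, s). T \<omega> s) \<in> F k \<Otimes>\<^sub>M D \<rightarrow>\<^sub>M borel \<and>
           (\<forall>\<omega>\<in>space M. \<forall>s\<in>space D.
              T \<omega> s \<in> resolvent \<gamma> (A s) (x k \<omega> + \<gamma> *\<^sub>R (fam k \<omega> s - a k \<omega>))) \<and>
           (\<forall>\<omega>\<in>space M. x (Suc k) \<omega> = T \<omega> (\<xi> k \<omega>))"
    and heads: "\<omega> \<in> space M \<Longrightarrow> \<theta> k \<omega> \<Longrightarrow>
      w (Suc k) \<omega> = x (Suc k) \<omega> \<and> a (Suc k) \<omega> \<in> expected_op D A (x (Suc k) \<omega>)"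
    and tails: "\<omega> \<in> space M \<Longrightarrow> \<not> \<theta> k \<omega> \<Longrightarrow> w (Suc k) \<omega> = w k \<omega> \<and> a (Suc k) \<omega> = a k \<omega>"

definition lyapunov :: "real \<Rightarrow> real \<Rightarrow> real \<Rightarrow> 'a::real_normed_vector \<Rightarrow> 'a \<Rightarrow> 'a \<Rightarrow> real" where
  "lyapunov \<gamma> \<mu> p xs x w = (norm (x - xs))\<^sup>2 + \<gamma> * \<mu> / p * (norm (w - xs))\<^sup>2"

text \<open>
  When \<open>\<delta> > \<mu>\<close> and \<open>\<gamma>\<close> is large, \<open>rate\<close> exceeds \<open>1\<close>. The expectation bound then still holds, but the
  iterates need not converge: with \<open>p = 1\<close>, \<open>x0 = w0 \<noteq> 0\<close>, \<open>A \<xi> x = {c \<xi> * x}\<close> on the reals, \<open>c \<xi> \<in> {1, 100}\<close> with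
  equal probability and \<open>\<gamma> = 100\<close>, they diverge almost surely.
\<close>

definition rate :: "real \<Rightarrow> real \<Rightarrow> real \<Rightarrow> real \<Rightarrow> real" where
  "rate \<gamma> \<mu> \<delta> p =
     max (1 / (1 + \<gamma> * \<mu>)) (1 - p + \<gamma> * \<delta>\<^sup>2 * p / (\<mu> * (1 + \<gamma> * \<mu>)))"

end

theory Submission
  imports Defs
begin

text \<open>
  With \<open>a\<^sup>\<star>\<close> the family supplied by expected similarity at \<open>(w\<^sup>k, a\<^sup>k)\<close>, the solution \<open>x\<^sup>\<star>\<close> is the
  resolvent of \<open>x\<^sup>\<star> + \<gamma> a\<^sup>\<star>\<close>. As the resolvent is \<open>1 / (1 + \<gamma> \<mu>)\<close>-Lipschitz and \<open>h\<^sup>k - a\<^sup>\<star>\<close> is centred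
  given the past, the mean of \<open>(1 + \<gamma> \<mu>)\<^sup>2 \<parallel>x\<^bsup>k+1\<^esup> - x\<^sup>\<star>\<parallel>\<^sup>2\<close> given the past is at most
  \<open>\<parallel>x\<^sup>k - x\<^sup>\<star>\<parallel>\<^sup>2 + \<gamma>\<^sup>2 \<delta>\<^sup>2 \<parallel>w\<^sup>k - x\<^sup>\<star>\<parallel>\<^sup>2\<close>. Averaging over the coin, the weight \<open>\<gamma> \<mu> / p\<close> turns this into
  \<open>E V\<^bsup>k+1\<^esup> \<le> rate * E V\<^sup>k\<close>. If \<open>rate < 1\<close>, the sum of all \<open>V\<^sup>k\<close> has finite mean, so \<open>V\<^sup>k\<close> tends to \<open>0\<close>
  almost surely.
\<close>

section \<open>Contraction of the resolvent\<close>

lemma resolvent_contraction: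
  assumes "strongly_maximally_monotone \<mu> B" "0 \<le> \<gamma>"
    and "y \<in> resolvent \<gamma> B z" "y' \<in> resolvent \<gamma> B z'"
  shows "(1 + \<gamma> * \<mu>) * norm (y - y') \<le> norm (z - z')"
proof (cases "y = y'")
  case False
  obtain u where u: "u \<in> B y" "z = y + \<gamma> *\<^sub>R u"
    using assms(3) by (auto simp: resolvent_def)
  obtain v where v: "v \<in> B y'" "z' = y' + \<gamma> *\<^sub>R v"
    using assms(4) by (auto simp: resolvent_def)
  have "\<mu> * (norm (y - y'))\<^sup>2 \<le> (u - v) \<bullet> (y - y')"
    using assms(1) u(1) v(1) by (auto simp: strongly_maximally_monotone_def gra_def)
  then have "\<gamma> * (\<mu> * (norm (y - y'))\<^sup>2) \<le> \<gamma> * ((u - v) \<bullet> (y - y'))"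
    using assms(2) by (rule mult_left_mono)
  \<comment> \<open>Pairing \<open>z - z'\<close> with \<open>y - y'\<close> turns strong
    monotonicity into the factor \<open>1 + \<gamma> * \<mu>\<close>. Cauchy-Schwarz then leaves one
    factor \<open>norm (y - y')\<close> to cancel, which is why the case \<open>y = y'\<close> is
    split off.\<close>
  moreover have "(z - z') \<bullet> (y - y') = (norm (y - y'))\<^sup>2 + \<gamma> * ((u - v) \<bullet> (y - y'))"
    unfolding u(2) v(2) power2_norm_eq_inner by (simp add: inner_diff_left inner_add_left algebra_simps)
  ultimately have "(1 + \<gamma> * \<mu>) * (norm (y - y'))\<^sup>2 \<le> (z - z') \<bullet> (y - y')"
    by (simp add: algebra_simps)
  also have "\<dots> \<le> norm (z - z') * norm (y - y')"
    by (rule norm_cauchy_schwarz)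
  finally show ?thesis
    using False by (simp add: power2_eq_square flip: mult.assoc)
qed simp

section \<open>Averaging over one sample, independence, and almost sure convergence\<close>

context prob_space
begin

text \<open>In the expanded square the cross term is linear in \<open>g\<close>, so it vanishes with
  the mean of \<open>g\<close>. This is where variance reduction pays off: noise enters only at
  second order.\<close>

lemma integral_norm_add_centred:
  fixes g :: "'a \<Rightarrow> 'b::euclidean_space"
  assumes g: "integrable M g" and sq: "integrable M (\<lambda>s. (norm (g s))\<^sup>2)"
    and 0: "(\<integral>s. g s \<partial>M) = 0"
  shows "integrable M (\<lambda>s. (norm (c + \<gamma> *\<^sub>R g s))\<^sup>2)"
    and "(\<integral>s. (norm (c + \<gamma> *\<^sub>R g s))\<^sup>2 \<partial>M) = (norm c)\<^sup>2 + \<gamma>\<^sup>2 * (\<integral>s. (norm (g s))\<^sup>2 \<partial>M)"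
proof -
  have eq: "(norm (c + \<gamma> *\<^sub>R g s))\<^sup>2 = (norm c)\<^sup>2 + 2 * \<gamma> * (c \<bullet> g s) + \<gamma>\<^sup>2 * (norm (g s))\<^sup>2" for s
    by (simp only: power2_norm_eq_inner)
      (simp add: inner_add_left inner_add_right inner_commute power2_eq_square algebra_simps)
  note [simp, intro] = g sq
  show "integrable M (\<lambda>s. (norm (c + \<gamma> *\<^sub>R g s))\<^sup>2)"
    unfolding eq by (intro Bochner_Integration.integrable_add integrable_mult_right
        integrable_inner_right integrable_const) auto
  show "(\<integral>s. (norm (c + \<gamma> *\<^sub>R g s))\<^sup>2 \<partial>M) = (norm c)\<^sup>2 + \<gamma>\<^sup>2 * (\<integral>s. (norm (g s))\<^sup>2 \<partial>M)"
    unfolding eq using 0 by (simp add: prob_space)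
qed

text \<open>The nonnegative integral allows the pointwise contraction estimate to be integrated
  before anything is known about integrability of the left side.\<close>

lemma nn_integral_resolvent_step:
  fixes A :: "'a \<Rightarrow> 'b::euclidean_space \<Rightarrow> 'b set"
  assumes pos: "0 < \<mu>" "0 \<le> \<gamma>"
    and mono: "\<And>s. s \<in> space M \<Longrightarrow> strongly_maximally_monotone \<mu> (A s)"
    and sim: "expected_similarity M A xs \<delta>"
    and sel: "selection M A w b"
    and y: "\<And>s. s \<in> space M \<Longrightarrow> y s \<in> resolvent \<gamma> (A s) (x + \<gamma> *\<^sub>R (b s - (\<integral>s. b s \<partial>M)))"
  shows "(\<integral>\<^sup>+s. ennreal ((norm (y s - xs))\<^sup>2) \<partial>M)
    \<le> ennreal (((norm (x - xs))\<^sup>2 + \<gamma>\<^sup>2 * \<delta>\<^sup>2 * (norm (w - xs))\<^sup>2) / (1 + \<gamma> * \<mu>)\<^sup>2)"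
proof -
  obtain as where as: "selection M A xs as" "(\<integral>s. as s \<partial>M) = 0"
    "integrable M (\<lambda>s. (norm (b s - (\<integral>s. b s \<partial>M) - as s))\<^sup>2)"
    "(\<integral>s. (norm (b s - (\<integral>s. b s \<partial>M) - as s))\<^sup>2 \<partial>M) \<le> \<delta>\<^sup>2 * (norm (w - xs))\<^sup>2"
    using sim sel unfolding expected_similarity_def by blast
  \<comment> \<open>The two resolvent arguments being compared differ by
    \<open>(x - xs) + \<gamma> *\<^sub>R g s\<close>. The mean of \<open>g\<close> is zero, since
    \<open>b\<close> has been centred and \<open>as\<close> has mean zero, and its second moment is
    the quantity controlled by expected similarity.\<close>
  define g where "g s = b s - (\<integral>s. b s \<partial>M) - as s" for s
  have int_b: "integrable M b" and int_as: "integrable M as"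
    using sel as(1) by (auto simp: selection_def)
  have int_g: "integrable M g" "(\<integral>s. g s \<partial>M) = 0" "integrable M (\<lambda>s. (norm (g s))\<^sup>2)"
    using int_b int_as as(2,3) unfolding g_def by (simp_all add: prob_space)
  have ge: "0 < 1 + \<gamma> * \<mu>"
    using pos by (simp add: add_pos_nonneg)
  have "(\<integral>\<^sup>+s. ennreal ((norm (y s - xs))\<^sup>2) \<partial>M)
    \<le> (\<integral>\<^sup>+s. ennreal ((norm ((x - xs) + \<gamma> *\<^sub>R g s))\<^sup>2 / (1 + \<gamma> * \<mu>)\<^sup>2) \<partial>M)"
  proof (intro nn_integral_mono ennreal_leI)
    fix s assume s: "s \<in> space M"
    have "xs \<in> resolvent \<gamma> (A s) (xs + \<gamma> *\<^sub>R as s)"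
      using as(1) s by (auto simp: resolvent_def selection_def)
    from resolvent_contraction[OF mono[OF s] pos(2) y[OF s] this]
    have "(1 + \<gamma> * \<mu>) * norm (y s - xs) \<le> norm ((x - xs) + \<gamma> *\<^sub>R g s)"
      by (simp add: g_def algebra_simps)
    then have "((1 + \<gamma> * \<mu>) * norm (y s - xs))\<^sup>2 \<le> (norm ((x - xs) + \<gamma> *\<^sub>R g s))\<^sup>2"
      using ge by (intro power_mono) auto
    then show "(norm (y s - xs))\<^sup>2 \<le> (norm ((x - xs) + \<gamma> *\<^sub>R g s))\<^sup>2 / (1 + \<gamma> * \<mu>)\<^sup>2"
      using ge by (simp add: power_mult_distrib pos_le_divide_eq mult.commute)
  qed
  also have "\<dots> = ennreal (((norm (x - xs))\<^sup>2 + \<gamma>\<^sup>2 * (\<integral>s. (norm (g s))\<^sup>2 \<partial>M)) / (1 + \<gamma> * \<mu>)\<^sup>2)"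
    by (subst nn_integral_eq_integral)
      (use integral_norm_add_centred[OF int_g(1,3,2)] in \<open>auto\<close>)
  also have "\<dots> \<le> ennreal (((norm (x - xs))\<^sup>2 + \<gamma>\<^sup>2 * (\<delta>\<^sup>2 * (norm (w - xs))\<^sup>2)) / (1 + \<gamma> * \<mu>)\<^sup>2)"
    using as(4) unfolding g_def
    by (intro ennreal_leI divide_right_mono add_left_mono mult_left_mono) auto
  finally show ?thesis
    by (simp add: mult.assoc)
qed

lemma nn_integral_cmult_add_const:
  assumes "f \<in> borel_measurable M"
  shows "(\<integral>\<^sup>+s. c * f s + d \<partial>M) = c * (\<integral>\<^sup>+s. f s \<partial>M) + d"
  using assms by (simp add: nn_integral_add nn_integral_cmult emeasure_space_1)

text \<open>Not an instance of the theory of \<open>indep_var\<close>, which forces \<open>X\<close> and \<open>Y\<close> to have the same type.\<close>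

lemma nn_integral_indep:
  assumes X: "X \<in> M \<rightarrow>\<^sub>M S" and Y: "Y \<in> M \<rightarrow>\<^sub>M T"
    and indep: "indep_set (events_of (space M) X S) (events_of (space M) Y T)"
    and f: "f \<in> borel_measurable (S \<Otimes>\<^sub>M T)"
  shows "(\<integral>\<^sup>+\<omega>. f (X \<omega>, Y \<omega>) \<partial>M) = (\<integral>\<^sup>+\<omega>. (\<integral>\<^sup>+t. f (X \<omega>, t) \<partial>distr M T Y) \<partial>M)"
proof -
  note [measurable] = X Y
  interpret X: prob_space "distr M S X"
    using X by (rule prob_space_distr)
  interpret Y: prob_space "distr M T Y"
    using Y by (rule prob_space_distr)
  \<comment> \<open>Independence makes the joint law a product law. It suffices to compare the two
    on rectangles, whose preimages are intersections of one event from each \<sigma>-algebra;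
    Tonelli then gives the iterated integral.\<close>
  have "distr M S X \<Otimes>\<^sub>M distr M T Y = distr M (S \<Otimes>\<^sub>M T) (\<lambda>\<omega>. (X \<omega>, Y \<omega>))"
  proof (rule pair_measure_eqI)
    fix A B assume "A \<in> sets (distr M S X)" "B \<in> sets (distr M T Y)"
    then have [measurable]: "A \<in> sets S" "B \<in> sets T"
      by simp_all
    then have "X -` A \<inter> space M \<in> events_of (space M) X S" "Y -` B \<inter> space M \<in> events_of (space M) Y T"
      by (simp_all add: in_vimage_algebra)
    from indep_setD[OF indep this]
    have "prob ((\<lambda>\<omega>. (X \<omega>, Y \<omega>)) -` (A \<times> B) \<inter> space M) = prob (X -` A \<inter> space M) * prob (Y -` B \<inter> space M)"
      by (rule back_subst[of "\<lambda>E. prob E = _"]) auto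
    then show "emeasure (distr M S X) A * emeasure (distr M T Y) B
      = emeasure (distr M (S \<Otimes>\<^sub>M T) (\<lambda>\<omega>. (X \<omega>, Y \<omega>))) (A \<times> B)"
      by (simp add: emeasure_distr emeasure_eq_measure ennreal_mult')
  qed (simp_all add: X.sigma_finite_measure_axioms Y.sigma_finite_measure_axioms)
  then have "(\<integral>\<^sup>+\<omega>. f (X \<omega>, Y \<omega>) \<partial>M) = (\<integral>\<^sup>+z. f z \<partial>(distr M S X \<Otimes>\<^sub>M distr M T Y))"
    using X Y f by (simp add: nn_integral_distr)
  also have "\<dots> = (\<integral>\<^sup>+\<omega>. (\<integral>\<^sup>+t. f (\<omega>, t) \<partial>distr M T Y) \<partial>distr M S X)"
    using f by (intro Y.nn_integral_fst[symmetric]) simp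
  also have "\<dots> = (\<integral>\<^sup>+\<omega>. (\<integral>\<^sup>+t. f (X \<omega>, t) \<partial>distr M T Y) \<partial>M)"
    using X f by (intro nn_integral_distr Y.borel_measurable_nn_integral) simp_all
  finally show ?thesis .
qed

lemma nn_integral_distr_bool:
  assumes "\<theta> \<in> M \<rightarrow>\<^sub>M count_space UNIV" "prob {\<omega>\<in>space M. \<theta> \<omega>} = p"
  shows "(\<integral>\<^sup>+t. f t \<partial>distr M (count_space UNIV) \<theta>) = ennreal p * f True + ennreal (1 - p) * f False"
proof -
  have [measurable]: "\<theta> \<in> M \<rightarrow>\<^sub>M count_space UNIV" by fact
  have "prob {\<omega>\<in>space M. \<not> \<theta> \<omega>} = 1 - p"
    using prob_neg[of \<theta>] assms(2) by simp
  moreover have "\<theta> -` {True} \<inter> space M = {\<omega>\<in>space M. \<theta> \<omega>}" "\<theta> -` {False} \<inter> space M = {\<omega>\<in>space M. \<not> \<theta> \<omega>}"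
    by auto
  ultimately have "emeasure (distr M (count_space UNIV) \<theta>) {True} = ennreal p"
    "emeasure (distr M (count_space UNIV) \<theta>) {False} = ennreal (1 - p)"
    using assms(2) by (auto simp: emeasure_distr emeasure_eq_measure)
  \<comment> \<open>Any function on \<open>bool\<close> is a combination of the indicators of the
    two atoms, whose masses have just been computed.\<close>
  moreover have "(\<integral>\<^sup>+t. f t \<partial>distr M (count_space UNIV) \<theta>)
      = (\<integral>\<^sup>+t. f True * indicator {True} t + f False * indicator {False} t \<partial>distr M (count_space UNIV) \<theta>)"
    by (intro nn_integral_cong) (simp split: split_indicator)
  moreover have "\<dots> = (\<integral>\<^sup>+t. f True * indicator {True} t \<partial>distr M (count_space UNIV) \<theta>)
      + (\<integral>\<^sup>+t. f False * indicator {False} t \<partial>distr M (count_space UNIV) \<theta>)"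
    by (rule nn_integral_add) simp_all
  ultimately show ?thesis
    by (simp add: nn_integral_cmult_indicator mult.commute)
qed

text \<open>Exchanging sum and integral and comparing with a geometric series shows that the series
  has finite mean. It is therefore finite almost everywhere, and the terms of a convergent series
  tend to 0.\<close>

lemma AE_tendsto_0_if_geometric:
  fixes V :: "nat \<Rightarrow> 'a \<Rightarrow> real"
  assumes meas[measurable]: "\<And>k. V k \<in> borel_measurable M" and nonneg: "\<And>k \<omega>. 0 \<le> V k \<omega>"
    and bound: "\<And>k. (\<integral>\<^sup>+\<omega>. V k \<omega> \<partial>M) \<le> ennreal (r ^ k * C)" and r: "0 \<le> r" "r < 1" and C: "0 \<le> C"
  shows "AE \<omega> in M. (\<lambda>k. V k \<omega>) \<longlonglongrightarrow> 0"
proof -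
  have "(\<integral>\<^sup>+\<omega>. (\<Sum>k. ennreal (V k \<omega>)) \<partial>M) = (\<Sum>k. \<integral>\<^sup>+\<omega>. V k \<omega> \<partial>M)"
    by (rule nn_integral_suminf) measurable
  also have "\<dots> \<le> (\<Sum>k. ennreal (r ^ k * C))"
    by (intro suminf_le bound) auto
  also have "\<dots> = ennreal (\<Sum>k. r ^ k * C)"
    using r C by (intro suminf_ennreal2 summable_mult2 summable_geometric) auto
  finally have "(\<integral>\<^sup>+\<omega>. (\<Sum>k. ennreal (V k \<omega>)) \<partial>M) \<noteq> \<infinity>"
    by (auto simp: top_unique)
  then have "AE \<omega> in M. (\<Sum>k. ennreal (V k \<omega>)) \<noteq> \<infinity>"
    by (intro nn_integral_noteq_infinite) measurable
  then show ?thesis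
  proof eventually_elim
    case (elim \<omega>)
    then have "summable (\<lambda>k. V k \<omega>)"
      using nonneg by (intro summable_suminf_not_top) auto
    then show ?case
      by (rule summable_LIMSEQ_zero)
  qed
qed

end

section \<open>Adaptedness of the iterates and the one-step Lyapunov estimate\<close>

context lsvrp
begin

lemma space_past: "space (F k) = space M"
  using past[of k] by (simp add: subalgebra_def)

lemma measurable_past: "f \<in> F k \<rightarrow>\<^sub>M N \<Longrightarrow> f \<in> M \<rightarrow>\<^sub>M N"
  using measurable_from_subalg[OF past] .

text \<open>Adaptedness propagates by induction: the new \<open>x\<close> is a measurable function
  of the past and the sample, and the new \<open>w\<close> selects between it and the old
  \<open>w\<close> by the coin. It makes \<open>w k\<close> a function of the past alone when the
  coin and the sample are averaged out below.\<close>

lemma iterates_measurable: "x k \<in> borel_measurable (F k)" "w k \<in> borel_measurable (F k)"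
proof (induction k)
  case 0
  { case 1
    have "x 0 \<in> borel_measurable (F 0) \<longleftrightarrow> (\<lambda>_. x0) \<in> borel_measurable (F 0)"
      by (rule measurable_cong) (simp add: init space_past)
    then show ?case by simp
  next
    case 2
    have "w 0 \<in> borel_measurable (F 0) \<longleftrightarrow> (\<lambda>_. w0) \<in> borel_measurable (F 0)"
      by (rule measurable_cong) (simp add: init space_past)
    then show ?case by simp }
next
  case (Suc k)
  have sub: "subalgebra (F (Suc k)) (F k)"
    using sets_F_mono[of k "Suc k"] by (simp add: subalgebra_def space_F)
  \<comment> \<open>The identity, viewed as a map into the coarser \<open>F k\<close>, lets
    \<open>\<omega>\<close> itself stand for the past in the pair
    \<open>(\<omega>, \<xi> k \<omega>)\<close>.\<close>
  have [measurable]: "(\<lambda>\<omega>. \<omega>) \<in> F (Suc k) \<rightarrow>\<^sub>M F k"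
    by (rule measurable_from_subalg[OF sub]) simp
  have [measurable]: "w k \<in> borel_measurable (F (Suc k))"
    using measurable_from_subalg[OF sub Suc.IH(2)] .
  note [measurable] = sample_measurable[of k] coin_measurable[of k]
  obtain T where T[measurable]: "(\<lambda>(\<omega>, s). T \<omega> s) \<in> F k \<Otimes>\<^sub>M D \<rightarrow>\<^sub>M borel"
    and x: "\<forall>\<omega>\<in>space M. x (Suc k) \<omega> = T \<omega> (\<xi> k \<omega>)"
    using prox_step[of k] by blast
  have pair: "(\<lambda>\<omega>. (\<omega>, \<xi> k \<omega>)) \<in> F (Suc k) \<rightarrow>\<^sub>M F k \<Otimes>\<^sub>M D"
    by measurable
  have "(\<lambda>\<omega>. T \<omega> (\<xi> k \<omega>)) \<in> borel_measurable (F (Suc k))"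
    using measurable_compose[OF pair T] by simp
  moreover have "x (Suc k) \<in> borel_measurable (F (Suc k))
      \<longleftrightarrow> (\<lambda>\<omega>. T \<omega> (\<xi> k \<omega>)) \<in> borel_measurable (F (Suc k))"
    by (rule measurable_cong) (simp add: x space_past)
  ultimately have x'[measurable]: "x (Suc k) \<in> borel_measurable (F (Suc k))"
    by simp
  { case 1
    show ?case by (rule x')
  next
    case 2
    have "w (Suc k) \<in> borel_measurable (F (Suc k))
        \<longleftrightarrow> (\<lambda>\<omega>. if \<theta> k \<omega> then x (Suc k) \<omega> else w k \<omega>) \<in> borel_measurable (F (Suc k))"
      by (rule measurable_cong) (auto simp: heads tails space_past)
    then show ?case by simp }
qed

text \<open>Conditional expectations are replaced by two uses of \<open>nn_integral_indep\<close>: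
  the coin is integrated out first, against past and sample together, and the sample second, against
  the past.\<close>

lemma nn_integral_lyapunov_Suc_le:
  assumes pos: "0 < \<mu>" "0 < \<gamma>" "0 < p" "p \<le> 1"
    and mono: "\<And>s. s \<in> space D \<Longrightarrow> strongly_maximally_monotone \<mu> (A s)"
    and sim: "expected_similarity D A xs \<delta>"
  shows "(\<integral>\<^sup>+\<omega>. lyapunov \<gamma> \<mu> p xs (x (Suc k) \<omega>) (w (Suc k) \<omega>) \<partial>M)
    \<le> ennreal (rate \<gamma> \<mu> \<delta> p) * (\<integral>\<^sup>+\<omega>. lyapunov \<gamma> \<mu> p xs (x k \<omega>) (w k \<omega>) \<partial>M)"
proof -
  obtain T where T: "(\<lambda>(\<omega>, s). T \<omega> s) \<in> F k \<Otimes>\<^sub>M D \<rightarrow>\<^sub>M borel"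
    and Tres: "\<And>\<omega> s. \<omega> \<in> space M \<Longrightarrow> s \<in> space D \<Longrightarrow>
       T \<omega> s \<in> resolvent \<gamma> (A s) (x k \<omega> + \<gamma> *\<^sub>R (fam k \<omega> s - a k \<omega>))"
    and x: "\<And>\<omega>. \<omega> \<in> space M \<Longrightarrow> x (Suc k) \<omega> = T \<omega> (\<xi> k \<omega>)"
    using prox_step[of k] by blast
  note [measurable] = measurable_past[OF sample_measurable[of k]]
    measurable_past[OF coin_measurable[of k]] iterates_measurable(2)[of k]
  note [measurable] = measurable_past[OF iterates_measurable(1)[of k]]
    measurable_past[OF iterates_measurable(2)[of k]]
  have [measurable]: "(\<lambda>\<omega>. \<omega>) \<in> M \<rightarrow>\<^sub>M F k"
    by (rule measurable_past[of _ k]) simp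
  have pair[measurable]: "(\<lambda>\<omega>. (\<omega>, \<xi> k \<omega>)) \<in> M \<rightarrow>\<^sub>M F k \<Otimes>\<^sub>M D"
    by measurable
  define c where "c = \<gamma> * \<mu> / p"
  define q where "q = 1 + \<gamma> * \<mu>"
  \<comment> \<open>The identity \<open>p * c = q - 1\<close> explains the weight
    \<open>\<gamma> * \<mu> / p\<close>: after averaging over the coin, the squared distance of the
    new iterate has coefficient \<open>1 + p * c = q\<close>, which cancels one of the two factors
    \<open>q\<close> gained from the resolvent and leaves \<open>1 / q\<close>.\<close>
  have c: "0 < c" and q: "1 < q" and cp: "p * c = q - 1"
    using pos by (auto simp: c_def q_def)
  \<comment> \<open>\<open>f\<close> expresses the next Lyapunov value through past, sample and
    coin, and \<open>g\<close> is its mean over the coin.\<close>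
  define f :: "('w \<times> 's) \<times> bool \<Rightarrow> ennreal" where
    "f = (\<lambda>((\<omega>, s), t). lyapunov \<gamma> \<mu> p xs (T \<omega> s) (if t then T \<omega> s else w k \<omega>))"
  define g :: "'w \<times> 's \<Rightarrow> ennreal" where
    "g = (\<lambda>(\<omega>, s). ennreal (q * (norm (T \<omega> s - xs))\<^sup>2 + (1 - p) * c * (norm (w k \<omega> - xs))\<^sup>2))"
  have T': "(\<lambda>z. T (fst z) (snd z)) \<in> borel_measurable (F k \<Otimes>\<^sub>M D)"
    using T by (simp add: case_prod_beta')
  have f: "f \<in> borel_measurable ((F k \<Otimes>\<^sub>M D) \<Otimes>\<^sub>M count_space UNIV)"
    and g: "g \<in> borel_measurable (F k \<Otimes>\<^sub>M D)"
  proof -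
    note [measurable] = T'
    show "f \<in> borel_measurable ((F k \<Otimes>\<^sub>M D) \<Otimes>\<^sub>M count_space UNIV)"
      unfolding f_def lyapunov_def case_prod_beta' by measurable
    show "g \<in> borel_measurable (F k \<Otimes>\<^sub>M D)"
      unfolding g_def case_prod_beta' by measurable
  qed
  have coin: "(\<integral>\<^sup>+t. f ((\<omega>, s), t) \<partial>distr M (count_space UNIV) (\<theta> k)) = g (\<omega>, s)" for \<omega> s
  proof -
    have "(\<integral>\<^sup>+t. f ((\<omega>, s), t) \<partial>distr M (count_space UNIV) (\<theta> k))
      = ennreal p * f ((\<omega>, s), True) + ennreal (1 - p) * f ((\<omega>, s), False)"
      by (rule nn_integral_distr_bool[OF _ coin_prob]) measurable
    also have "\<dots> = ennreal (p * ((norm (T \<omega> s - xs))\<^sup>2 + c * (norm (T \<omega> s - xs))\<^sup>2)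
        + (1 - p) * ((norm (T \<omega> s - xs))\<^sup>2 + c * (norm (w k \<omega> - xs))\<^sup>2))"
      using pos c by (simp add: f_def lyapunov_def ennreal_mult' flip: c_def)
    also have "p * ((norm (T \<omega> s - xs))\<^sup>2 + c * (norm (T \<omega> s - xs))\<^sup>2)
        + (1 - p) * ((norm (T \<omega> s - xs))\<^sup>2 + c * (norm (w k \<omega> - xs))\<^sup>2)
      = (1 + p * c) * (norm (T \<omega> s - xs))\<^sup>2 + (1 - p) * c * (norm (w k \<omega> - xs))\<^sup>2"
      by (simp add: algebra_simps)
    finally show ?thesis
      by (simp add: g_def cp)
  qed
  \<comment> \<open>The past is frozen at \<open>\<omega>\<close>. The family supplied by expected
    similarity is obtained separately for each \<open>\<omega>\<close>, so no measurable choice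
    across different \<open>\<omega>\<close> has to be made.\<close>
  have step: "(\<integral>\<^sup>+s. g (\<omega>, s) \<partial>D)
      \<le> ennreal (rate \<gamma> \<mu> \<delta> p) * ennreal (lyapunov \<gamma> \<mu> p xs (x k \<omega>) (w k \<omega>))"
    if \<omega>: "\<omega> \<in> space M" for \<omega>
  proof -
    let ?X = "(norm (x k \<omega> - xs))\<^sup>2" and ?W = "(norm (w k \<omega> - xs))\<^sup>2"
    have "\<omega> \<in> space (F k)"
      using \<omega> by (simp add: space_past)
    then have [measurable]: "T \<omega> \<in> borel_measurable D"
      using measurable_compose[OF measurable_Pair1' T] by simp
    have "(\<integral>\<^sup>+s. g (\<omega>, s) \<partial>D) = (\<integral>\<^sup>+s. ennreal q * ennreal ((norm (T \<omega> s - xs))\<^sup>2) + ennreal ((1 - p) * c * ?W) \<partial>D)"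
      using q c pos by (simp add: g_def ennreal_mult')
    also have "\<dots> = ennreal q * (\<integral>\<^sup>+s. ennreal ((norm (T \<omega> s - xs))\<^sup>2) \<partial>D) + ennreal ((1 - p) * c * ?W)"
      by (rule D.nn_integral_cmult_add_const) measurable
    also have "\<dots> \<le> ennreal q * ennreal ((?X + \<gamma>\<^sup>2 * \<delta>\<^sup>2 * ?W) / q\<^sup>2) + ennreal ((1 - p) * c * ?W)"
    proof (intro add_right_mono mult_left_mono)
      show "(\<integral>\<^sup>+s. ennreal ((norm (T \<omega> s - xs))\<^sup>2) \<partial>D) \<le> ennreal ((?X + \<gamma>\<^sup>2 * \<delta>\<^sup>2 * ?W) / q\<^sup>2)"
        unfolding q_def
        by (rule D.nn_integral_resolvent_step[OF _ _ mono sim, where b = "fam k \<omega>"])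
          (use fam_selection[OF \<omega>, of k] Tres[OF \<omega>] pos in auto)
    qed simp
    also have "\<dots> = ennreal (q * ((?X + \<gamma>\<^sup>2 * \<delta>\<^sup>2 * ?W) / q\<^sup>2) + (1 - p) * c * ?W)"
      using q c pos by (simp add: ennreal_mult' del: times_divide_eq_right)
    also have "\<dots> \<le> ennreal (rate \<gamma> \<mu> \<delta> p * lyapunov \<gamma> \<mu> p xs (x k \<omega>) (w k \<omega>))"
    proof (rule ennreal_leI)
      \<comment> \<open>Extracting the weight \<open>c\<close> from the noise term
        \<open>\<gamma>\<^sup>2 * \<delta>\<^sup>2 * ?W / q\<close> leaves
        \<open>\<gamma> * \<delta>\<^sup>2 * p / (\<mu> * q)\<close>. The coefficients of
        \<open>?X\<close> and \<open>c * ?W\<close> are then exactly the two entries of the maximum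
        in \<open>rate\<close>.\<close>
      have "q * ((?X + \<gamma>\<^sup>2 * \<delta>\<^sup>2 * ?W) / q\<^sup>2) + (1 - p) * c * ?W
        = 1 / q * ?X + (1 - p + \<gamma> * \<delta>\<^sup>2 * p / (\<mu> * q)) * (c * ?W)"
        using q pos by (simp add: c_def field_simps power2_eq_square)
      also have "\<dots> \<le> rate \<gamma> \<mu> \<delta> p * ?X + rate \<gamma> \<mu> \<delta> p * (c * ?W)"
        using c unfolding rate_def q_def by (intro add_mono mult_right_mono) auto
      also have "\<dots> = rate \<gamma> \<mu> \<delta> p * lyapunov \<gamma> \<mu> p xs (x k \<omega>) (w k \<omega>)"
        by (simp add: lyapunov_def c_def distrib_left)
      finally show "q * ((?X + \<gamma>\<^sup>2 * \<delta>\<^sup>2 * ?W) / q\<^sup>2) + (1 - p) * c * ?W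
        \<le> rate \<gamma> \<mu> \<delta> p * lyapunov \<gamma> \<mu> p xs (x k \<omega>) (w k \<omega>)" .
    qed
    also have "\<dots> = ennreal (rate \<gamma> \<mu> \<delta> p) * ennreal (lyapunov \<gamma> \<mu> p xs (x k \<omega>) (w k \<omega>))"
      using pos by (intro ennreal_mult'') (simp add: lyapunov_def)
    finally show ?thesis .
  qed
  have "(\<integral>\<^sup>+\<omega>. lyapunov \<gamma> \<mu> p xs (x (Suc k) \<omega>) (w (Suc k) \<omega>) \<partial>M)
      = (\<integral>\<^sup>+\<omega>. f ((\<omega>, \<xi> k \<omega>), \<theta> k \<omega>) \<partial>M)"
    by (intro nn_integral_cong) (auto simp: f_def x heads tails)
  also have "\<dots> = (\<integral>\<^sup>+\<omega>. g (\<omega>, \<xi> k \<omega>) \<partial>M)"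
    by (subst nn_integral_indep[OF pair _ coin_indep f]) (simp_all add: coin)
  also have "\<dots> = (\<integral>\<^sup>+\<omega>. (\<integral>\<^sup>+s. g (\<omega>, s) \<partial>D) \<partial>M)"
  proof -
    \<comment> \<open>The identity map generates \<open>F k\<close> itself, so
      \<open>sample_indep\<close> becomes an independence statement about two random
      elements.\<close>
    have "events_of (space M) (\<lambda>\<omega>. \<omega>) (F k) = sets (F k)"
      using sets.Int_space_eq2[of _ "F k"]
      by (simp add: sets_vimage_algebra2 space_past Setcompr_eq_image cong: image_cong_simp)
    then have "indep_set (events_of (space M) (\<lambda>\<omega>. \<omega>) (F k)) (events_of (space M) (\<xi> k) D)"
      using sample_indep[of k] by simp
    from nn_integral_indep[OF _ _ this g] show ?thesis
      by (simp add: sample_distr)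
  qed
  also have "\<dots> \<le> (\<integral>\<^sup>+\<omega>. ennreal (rate \<gamma> \<mu> \<delta> p) * ennreal (lyapunov \<gamma> \<mu> p xs (x k \<omega>) (w k \<omega>)) \<partial>M)"
    by (intro nn_integral_mono step)
  also have "\<dots> = ennreal (rate \<gamma> \<mu> \<delta> p) * (\<integral>\<^sup>+\<omega>. lyapunov \<gamma> \<mu> p xs (x k \<omega>) (w k \<omega>) \<partial>M)"
    unfolding lyapunov_def by (intro nn_integral_cmult) measurable
  finally show ?thesis .
qed

end

section \<open>Iterating the estimate: geometric decay in mean and almost sure limits\<close>

theorem theorem3:
  fixes M :: "'w measure" and D :: "'s measure" and F :: "nat \<Rightarrow> 'w measure"
    and A :: "'s \<Rightarrow> 'a::euclidean_space \<Rightarrow> 'a set"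
    and \<mu> \<delta> \<gamma> p :: real
    and xstar x0 w0 a0 :: 'a
    and \<xi> :: "nat \<Rightarrow> 'w \<Rightarrow> 's" and \<theta> :: "nat \<Rightarrow> 'w \<Rightarrow> bool"
    and fam :: "nat \<Rightarrow> 'w \<Rightarrow> 's \<Rightarrow> 'a"
    and a x w :: "nat \<Rightarrow> 'w \<Rightarrow> 'a"
  assumes "0 < \<mu>" and "0 < \<delta>" and "0 < \<gamma>" and "0 < p" and "p \<le> 1"
    and "\<And>s. s \<in> space D \<Longrightarrow> strongly_maximally_monotone \<mu> (A s)"
    and "strongly_maximally_monotone \<mu> (expected_op D A)"
    and "0 \<in> expected_op D A xstar"
    and "\<And>y. 0 \<in> expected_op D A y \<Longrightarrow> y = xstar"
    and "expected_similarity D A xstar \<delta>"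
    and "lsvrp M D F A \<gamma> p x0 w0 a0 \<xi> \<theta> fam a x w"
  shows "(\<forall>k. integrable M (\<lambda>\<omega>. lyapunov \<gamma> \<mu> p xstar (x k \<omega>) (w k \<omega>)) \<and>
              (\<integral>\<omega>. lyapunov \<gamma> \<mu> p xstar (x k \<omega>) (w k \<omega>) \<partial>M)
                \<le> rate \<gamma> \<mu> \<delta> p ^ k * lyapunov \<gamma> \<mu> p xstar x0 w0) \<and>
         (rate \<gamma> \<mu> \<delta> p < 1 \<longrightarrow>
            (AE \<omega> in M. (\<lambda>k. x k \<omega>) \<longlonglongrightarrow> xstar \<and> (\<lambda>k. w k \<omega>) \<longlonglongrightarrow> xstar))"
proof -
  interpret lsvrp M D F A \<gamma> p x0 w0 a0 \<xi> \<theta> fam a x w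
    by (fact assms(11))
  define V where "V k \<omega> = lyapunov \<gamma> \<mu> p xstar (x k \<omega>) (w k \<omega>)" for k \<omega>
  define r where "r = rate \<gamma> \<mu> \<delta> p"
  define V0 where "V0 = lyapunov \<gamma> \<mu> p xstar x0 w0"
  note pos = assms(1-5)
  have r: "0 \<le> r"
    using pos by (auto simp: r_def rate_def le_max_iff_disj)
  have V_nonneg: "0 \<le> V k \<omega>" and V0: "0 \<le> V0" for k \<omega>
    using pos by (simp_all add: V_def V0_def lyapunov_def)
  have [measurable]: "V k \<in> borel_measurable M" for k
  proof -
    note [measurable] = measurable_past[OF iterates_measurable(1)[of k]]
      measurable_past[OF iterates_measurable(2)[of k]]
    show ?thesis
      unfolding V_def lyapunov_def by measurable
  qed
  \<comment> \<open>The induction runs on nonnegative integrals; integrability of each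
    \<open>V k\<close> is then read off from the finite bound.\<close>
  have bound: "(\<integral>\<^sup>+\<omega>. V k \<omega> \<partial>M) \<le> ennreal (r ^ k * V0)" for k
  proof (induction k)
    case 0
    have "(\<integral>\<^sup>+\<omega>. V 0 \<omega> \<partial>M) = (\<integral>\<^sup>+\<omega>. V0 \<partial>M)"
      by (intro nn_integral_cong) (simp add: V_def V0_def init)
    then show ?case
      by (simp add: emeasure_space_1)
  next
    case (Suc k)
    have "(\<integral>\<^sup>+\<omega>. V (Suc k) \<omega> \<partial>M) \<le> ennreal r * (\<integral>\<^sup>+\<omega>. V k \<omega> \<partial>M)"
      unfolding V_def r_def
      by (rule nn_integral_lyapunov_Suc_le[OF pos(1,3,4,5) assms(6,10)])
    also have "\<dots> \<le> ennreal r * ennreal (r ^ k * V0)"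
      using Suc.IH by (rule mult_left_mono) simp
    also have "\<dots> = ennreal (r ^ Suc k * V0)"
      using r by (simp add: ennreal_mult' mult.assoc)
    finally show ?case .
  qed
  have int: "integrable M (V k)" for k
    using bound[of k] V_nonneg
    by (intro integrableI_nonneg) (auto simp: less_top[symmetric] top_unique)
  have "(\<integral>\<omega>. V k \<omega> \<partial>M) \<le> r ^ k * V0" for k
    using bound[of k] int[of k] V_nonneg r V0
    by (subst (asm) nn_integral_eq_integral) auto
  moreover have "AE \<omega> in M. (\<lambda>k. x k \<omega>) \<longlonglongrightarrow> xstar \<and> (\<lambda>k. w k \<omega>) \<longlonglongrightarrow> xstar" if "r < 1"
  proof -
    \<comment> \<open>Each summand of \<open>V k\<close> is dominated by the whole, so one argument
      serves both sequences: \<open>c = 1\<close> for \<open>x\<close> and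
      \<open>c = \<gamma> * \<mu> / p\<close> for \<open>w\<close>.\<close>
    have lim: "u \<longlonglongrightarrow> xstar"
      if "(\<lambda>k. V k \<omega>) \<longlonglongrightarrow> 0" "0 < c" "\<And>k. c * (norm (u k - xstar))\<^sup>2 \<le> V k \<omega>" for u \<omega> c
    proof -
      have "(\<lambda>k. c * (norm (u k - xstar))\<^sup>2) \<longlonglongrightarrow> 0"
        using that by (intro tendsto_sandwich[OF _ _ tendsto_const that(1)]) auto
      from tendsto_mult_left[OF this, of "inverse c"] have "(\<lambda>k. (norm (u k - xstar))\<^sup>2) \<longlonglongrightarrow> 0"
        using that(2) by (simp flip: mult.assoc)
      from tendsto_real_sqrt[OF this] show ?thesis
        by (simp add: Lim_null[of u] tendsto_norm_zero_iff)
    qed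
    have "AE \<omega> in M. (\<lambda>k. V k \<omega>) \<longlonglongrightarrow> 0"
      using bound r that V0 V_nonneg by (intro AE_tendsto_0_if_geometric[where r = r and C = V0]) auto
    then show ?thesis
    proof eventually_elim
      case (elim \<omega>)
      show ?case
        using pos by (intro conjI lim[OF elim, of 1] lim[OF elim, of "\<gamma> * \<mu> / p"])
          (auto simp: V_def lyapunov_def)
    qed
  qed
  ultimately show ?thesis
    using int unfolding V_def r_def V0_def by auto
qed

end
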